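(* Let $G$ be a weighted graph on $n$ vertices whose Laplacian $L(G)$ is diagonalisable by a dephased complex Hadamard matrix $H$ of order $n$, and let $\lambda_j$ be the eigenvalue of $L(G)$ for the $j$-th column of $H$, $j=1,\dots,n$. Let $a\neq b$ be vertices of $G$, let $\tau\in\mathbb R$, and let $\gamma\in(-\frac\pi2,\frac\pi2]$ with $\gamma\ne0$. Then $(e^{\mathrm i\gamma}\cos\gamma,\,-e^{\mathrm i\gamma}\,\mathrm i\sin\gamma)$-(Laplacian) fractional revival occurs from vertex $a$ to vertex $b$ in $G$ at time $\tau$ if and only if, for $j=1,\dots,n$, (1) $H_{a,j}=\pm H_{b,j}$, and (2) $-\tau\lambda_j\equiv\begin{cases}0\pmod{2\pi}&\text{if }H_{a,j}=H_{b,j},\\ 2\gamma\pmod{2\pi}&\text{if }H_{a,j}=-H_{b,j}.\end{cases}$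
   Context: Graphs are simple and weighted with non-negative real edge weights; $A(G)$ is the matrix of edge weights and $L(G)=D(G)-A(G)$, with $D(G)$ the diagonal matrix of row sums of $A(G)$. A complex Hadamard matrix of order $n$ is an $n\times n$ complex matrix $H$ whose entries all have modulus one and which satisfies $HH^*=nI$; it is dephased if its first row and first column are all-ones vectors. $L(G)$ is diagonalisable by $H$ if every column of $H$ is an eigenvector of $L(G)$. Rows of $H$ are indexed by the vertices of $G$. $\mathbf e_v$ is the characteristic (standard basis) vector of vertex $v$. For complex $\alpha$ and $\beta\ne0$ with $|\alpha|^2+|\beta|^2=1$, $(\alpha,\beta)$-(Laplacian) fractional revival occurs from $a$ to $b$ at time $\tau$ if $e^{-\mathrm i\tau L(G)}\mathbf e_a=\alpha\mathbf e_a+\beta\mathbf e_b$. *)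

theory Defs
  imports
    Complex_Main
    "HOL-Library.Real_Mod"
    "Jordan_Normal_Form.Schur_Decomposition"
begin

text \<open>
  A weighted graph on the vertices 0, ..., n - 1 is given by its weight function; \<open>u\<close> and \<open>v\<close> are
  adjacent iff \<open>w u v > 0\<close>. Rows and columns of matrices are indexed from 0, so the first row and
  the first column are those with index 0.
\<close>

definition weighted_graph :: "nat \<Rightarrow> (nat \<Rightarrow> nat \<Rightarrow> real) \<Rightarrow> bool" where
  "weighted_graph n w \<longleftrightarrow>
     (\<forall>u<n. \<forall>v<n. 0 \<le> w u v \<and> w u v = w v u) \<and> (\<forall>u<n. w u u = 0)"

definition adjacency_mat :: "nat \<Rightarrow> (nat \<Rightarrow> nat \<Rightarrow> real) \<Rightarrow> real mat" where
  "adjacency_mat n w = mat n n (\<lambda>(u, v). w u v)"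

definition degree_mat :: "nat \<Rightarrow> (nat \<Rightarrow> nat \<Rightarrow> real) \<Rightarrow> real mat" where
  "degree_mat n w = mat_diag n (\<lambda>u. \<Sum>v<n. adjacency_mat n w $$ (u, v))"

text \<open>The Laplacian, with its real entries regarded as complex numbers.\<close>

definition laplacian_mat :: "nat \<Rightarrow> (nat \<Rightarrow> nat \<Rightarrow> real) \<Rightarrow> complex mat" where
  "laplacian_mat n w = map_mat complex_of_real (degree_mat n w - adjacency_mat n w)"

definition complex_hadamard :: "nat \<Rightarrow> complex mat \<Rightarrow> bool" where
  "complex_hadamard n H \<longleftrightarrow>
     H \<in> carrier_mat n n \<and>
     (\<forall>i<n. \<forall>j<n. cmod (H $$ (i, j)) = 1) \<and>
     H * mat_adjoint H = of_nat n \<cdot>\<^sub>m 1\<^sub>m n"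

definition dephased :: "nat \<Rightarrow> complex mat \<Rightarrow> bool" where
  "dephased n H \<longleftrightarrow> (\<forall>j<n. H $$ (0, j) = 1) \<and> (\<forall>i<n. H $$ (i, 0) = 1)"

definition diagonalisable_by :: "complex mat \<Rightarrow> complex mat \<Rightarrow> bool" where
  "diagonalisable_by L H \<longleftrightarrow> (\<forall>j<dim_col H. \<exists>\<mu>. eigenvector L (col H j) \<mu>)"

text \<open>
  The exponential of a square matrix as its power series, summed entrywise. The matrix type carries
  no topology, so the library's \<open>exp\<close> is not available for it; each of the scalar series converges.
\<close>

definition mat_exp :: "complex mat \<Rightarrow> complex mat" where
  "mat_exp A = mat (dim_row A) (dim_col A)
     (\<lambda>(i, j). \<Sum>k. (A ^\<^sub>m k) $$ (i, j) / fact k)"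

definition fractional_revival ::
    "nat \<Rightarrow> (nat \<Rightarrow> nat \<Rightarrow> real) \<Rightarrow> complex \<Rightarrow> complex \<Rightarrow> nat \<Rightarrow> nat \<Rightarrow> real \<Rightarrow> bool" where
  "fractional_revival n w \<alpha> \<beta> a b \<tau> \<longleftrightarrow>
     \<beta> \<noteq> 0 \<and> (cmod \<alpha>)\<^sup>2 + (cmod \<beta>)\<^sup>2 = 1 \<and>
     mat_exp ((- \<i> * complex_of_real \<tau>) \<cdot>\<^sub>m laplacian_mat n w) *\<^sub>v unit_vec n a
       = \<alpha> \<cdot>\<^sub>v unit_vec n a + \<beta> \<cdot>\<^sub>v unit_vec n b"

end

theory Submission
  imports Defs
begin

text \<open>
  The columns of \<open>H\<close> and their complex conjugates form two orthogonal bases of eigenvectors of the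
  real symmetric matrix \<open>L\<close>. Pairing \<open>e\<^bsup>-\<i>\<tau>L\<^esup>e\<^sub>a = \<alpha>e\<^sub>a + \<beta>e\<^sub>b\<close> with the conjugated
  columns shows that it is equivalent to \<open>e\<^bsup>-\<i>\<tau>\<lambda>\<^sub>j\<^esup> = \<alpha> + \<beta>z\<^sub>j\<close> for all \<open>j\<close>, where \<open>z\<^sub>j\<close> is the complex
  conjugate of the unit number \<open>H\<^sub>b\<^sub>j / H\<^sub>a\<^sub>j\<close>. Pairing with the columns themselves gives the same
  equation with \<open>z\<^sub>j\<close> conjugated. As \<open>\<beta> \<noteq> 0\<close>, each \<open>z\<^sub>j\<close> is real, hence \<open>\<plusminus>1\<close>; and for the given
  \<open>\<alpha>\<close>, \<open>\<beta>\<close> one has \<open>\<alpha> + \<beta> = 1\<close> and \<open>\<alpha> - \<beta> = e\<^bsup>2\<i>\<gamma>\<^esup>\<close>.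
\<close>

text \<open>This lets the congruences of the theorem be handled as equations between phases.\<close>

lemma cis_eq_iff_rcong: "cis x = cis y \<longleftrightarrow> [x = y] (rmod (2 * pi))"
proof -
  have "cis x = cis y \<longleftrightarrow> (\<exists>k::int. y = x + 2 * pi * k)"
    using sin_cos_eq_iff[of y x] by (auto simp: complex_eq_iff)
  then show ?thesis
    by (simp add: rcong_altdef mult_ac)
qed

section \<open>The matrix exponential: convergence, eigenvectors, transposition\<close>

lemma pow_mat_entry_bound:
  fixes A :: "complex mat"
  assumes A: "A \<in> carrier_mat n n"
    and M: "\<And>i j. i < n \<Longrightarrow> j < n \<Longrightarrow> cmod (A $$ (i, j)) \<le> M"
    and ij: "i < n" "j < n"
  shows "cmod ((A ^\<^sub>m k) $$ (i, j)) \<le> (real n * M) ^ k"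
  using ij
proof (induction k arbitrary: i j)
  case 0
  then show ?case using A by simp
next
  case (Suc k)
  \<comment> \<open>The indices at hand show that the matrix has an entry, and \<open>M\<close>
    bounds its modulus.\<close>
  have M0: "0 \<le> M"
    using M[OF Suc.prems] norm_ge_zero order_trans by blast
  have "(A ^\<^sub>m Suc k) $$ (i, j) = (\<Sum>l = 0..<n. (A ^\<^sub>m k) $$ (i, l) * A $$ (l, j))"
    using A Suc.prems by (simp add: scalar_prod_def)
  also have "cmod \<dots> \<le> (\<Sum>l = 0..<n. (real n * M) ^ k * M)"
    using Suc M M0
    by (intro order_trans[OF norm_sum] sum_mono) (auto simp: norm_mult intro!: mult_mono)
  finally show ?case by (simp add: mult_ac)
qed

lemma mat_exp_entry_sums:
  assumes A: "A \<in> carrier_mat n n" and ij: "i < n" "j < n"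
  shows "(\<lambda>k. (A ^\<^sub>m k) $$ (i, j) / fact k) sums (mat_exp A $$ (i, j))"
proof -
  define M where "M = (\<Sum>i<n. \<Sum>j<n. cmod (A $$ (i, j)))"
  have M: "cmod (A $$ (i, j)) \<le> M" if "i < n" "j < n" for i j
  proof -
    have "cmod (A $$ (i, j)) \<le> (\<Sum>j<n. cmod (A $$ (i, j)))"
      using that by (intro member_le_sum) auto
    also have "\<dots> \<le> M"
      unfolding M_def using that
      by (intro member_le_sum[where f = "\<lambda>i. \<Sum>j<n. cmod (A $$ (i, j))"]) (auto intro: sum_nonneg)
    finally show ?thesis .
  qed
  \<comment> \<open>\<open>M\<close>, the sum of all moduli, dominates every entry, so the
    exponential series at \<open>real n * M\<close> is a majorant.\<close>
  have "summable (\<lambda>k. inverse (fact k) * (real n * M) ^ k)"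
    by (rule summable_exp)
  moreover have "cmod ((A ^\<^sub>m k) $$ (i, j) / fact k) \<le> inverse (fact k) * (real n * M) ^ k" for k
    using pow_mat_entry_bound[OF A M ij, of k] by (simp add: norm_divide field_simps)
  ultimately have "summable (\<lambda>k. (A ^\<^sub>m k) $$ (i, j) / fact k)"
    by (rule summable_comparison_test'[where N = 0])
  then show ?thesis
    using A ij by (simp add: mat_exp_def summable_sums)
qed

lemma mat_exp_carrier: "A \<in> carrier_mat n n \<Longrightarrow> mat_exp A \<in> carrier_mat n n"
  by (auto simp: mat_exp_def)

text \<open>Each power \<open>A ^\<^sub>m k\<close> scales \<open>v\<close> by
  \<open>\<mu> ^ k\<close>. A row of the product is a finite sum of convergent series, so it can be
  summed termwise to the scalar exponential series.\<close>

lemma mat_exp_eigenvector: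
  assumes A: "A \<in> carrier_mat n n" and v: "eigenvector A v \<mu>"
  shows "mat_exp A *\<^sub>v v = exp \<mu> \<cdot>\<^sub>v v"
proof (rule eq_vecI)
  have vn: "v \<in> carrier_vec n"
    using A v by (auto simp: eigenvector_def)
  show "dim_vec (mat_exp A *\<^sub>v v) = dim_vec (exp \<mu> \<cdot>\<^sub>v v)"
    using vn mat_exp_carrier[OF A] by simp
  fix i assume "i < dim_vec (exp \<mu> \<cdot>\<^sub>v v)"
  then have i: "i < n" using vn by simp
  have "(\<lambda>k. \<Sum>j = 0..<n. (A ^\<^sub>m k) $$ (i, j) / fact k * v $ j) sums
      (\<Sum>j = 0..<n. mat_exp A $$ (i, j) * v $ j)"
    using i by (intro sums_sum sums_mult2 mat_exp_entry_sums[OF A]) auto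
  moreover have "(\<Sum>j = 0..<n. (A ^\<^sub>m k) $$ (i, j) / fact k * v $ j) = \<mu> ^ k /\<^sub>R fact k * v $ i" for k
  proof -
    have "(\<Sum>j = 0..<n. (A ^\<^sub>m k) $$ (i, j) * v $ j) = (A ^\<^sub>m k *\<^sub>v v) $ i"
      using A vn i by (simp add: scalar_prod_def)
    also have "\<dots> = \<mu> ^ k * v $ i"
      using eigenvector_pow[OF A v] vn i by simp
    finally show ?thesis
      by (simp add: sum_divide_distrib[symmetric] scaleR_conv_of_real divide_inverse mult_ac
          sum_distrib_left[symmetric])
  qed
  moreover have "(\<lambda>k. \<mu> ^ k /\<^sub>R fact k * v $ i) sums (exp \<mu> * v $ i)"
    by (intro sums_mult2 exp_converges)
  ultimately have "(\<Sum>j = 0..<n. mat_exp A $$ (i, j) * v $ j) = exp \<mu> * v $ i"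
    using sums_unique2 by simp
  then show "(mat_exp A *\<^sub>v v) $ i = (exp \<mu> \<cdot>\<^sub>v v) $ i"
    using vn i mat_exp_carrier[OF A] by (simp add: scalar_prod_def)
qed

text \<open>The recursion for powers puts the new factor on the right; transposition moves it to the
  left.\<close>

lemma pow_mat_Suc_left:
  fixes A :: "'a :: semiring_1 mat"
  assumes A: "A \<in> carrier_mat n n"
  shows "A ^\<^sub>m Suc k = A * A ^\<^sub>m k"
proof (induction k)
  case (Suc k)
  have "A ^\<^sub>m Suc (Suc k) = A * A ^\<^sub>m k * A"
    using Suc by simp
  also have "\<dots> = A * A ^\<^sub>m Suc k"
    using A by (simp add: assoc_mult_mat[of _ n n _ n _ n])
  finally show ?case .
qed (use A in simp)

lemma transpose_pow_mat:
  fixes A :: "'a :: comm_semiring_1 mat"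
  assumes A: "A \<in> carrier_mat n n"
  shows "(A ^\<^sub>m k)\<^sup>T = A\<^sup>T ^\<^sub>m k"
proof (induction k)
  case (Suc k)
  have "(A ^\<^sub>m Suc k)\<^sup>T = A\<^sup>T * (A ^\<^sub>m k)\<^sup>T"
    using A by (simp add: transpose_mult[of _ n n _ n])
  also have "\<dots> = A\<^sup>T ^\<^sub>m Suc k"
    using A by (simp add: Suc pow_mat_Suc_left[of _ n] del: pow_mat.simps)
  finally show ?case .
qed (use A in simp)

lemma transpose_mat_exp:
  assumes A: "A \<in> carrier_mat n n"
  shows "(mat_exp A)\<^sup>T = mat_exp A\<^sup>T"
proof (rule eq_matI)
  fix i j assume "i < dim_row (mat_exp A\<^sup>T)" "j < dim_col (mat_exp A\<^sup>T)"
  then have ij: "i < n" "j < n" using A by (auto simp: mat_exp_def)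
  have "(A\<^sup>T ^\<^sub>m k) $$ (i, j) = (A ^\<^sub>m k) $$ (j, i)" for k
    using A ij by (simp add: transpose_pow_mat[OF A, symmetric])
  then show "(mat_exp A)\<^sup>T $$ (i, j) = mat_exp A\<^sup>T $$ (i, j)"
    using A ij by (simp add: mat_exp_def)
qed (auto simp: mat_exp_def)

text \<open>The product \<open>\<bullet>\<close> is bilinear, without conjugation, so moving a
  matrix across it yields the transpose. Symmetry, rather than self-adjointness, is therefore the
  right condition on a complex matrix here.\<close>

lemma scalar_prod_mat_exp_symmetric:
  assumes A: "A \<in> carrier_mat n n" and sym: "A\<^sup>T = A"
    and v: "eigenvector A v \<mu>" and u: "u \<in> carrier_vec n"
  shows "v \<bullet> (mat_exp A *\<^sub>v u) = exp \<mu> * (v \<bullet> u)"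
proof -
  have vn: "v \<in> carrier_vec n"
    using A v by (auto simp: eigenvector_def)
  have "v \<bullet> (mat_exp A *\<^sub>v u) = ((mat_exp A)\<^sup>T *\<^sub>v v) \<bullet> u"
    using transpose_vec_mult_scalar[OF mat_exp_carrier[OF A] u vn] by simp
  also have "\<dots> = (exp \<mu> \<cdot>\<^sub>v v) \<bullet> u"
    using mat_exp_eigenvector[OF A v] by (simp add: transpose_mat_exp[OF A] sym)
  finally show ?thesis
    using vn u by simp
qed

section \<open>Eigenvectors of the Laplacian and pairing with the Hadamard columns\<close>

lemma smult_mat_mult_vec:
  fixes A :: "'a :: comm_semiring_0 mat"
  assumes "A \<in> carrier_mat nr nc" and "v \<in> carrier_vec nc"
  shows "(c \<cdot>\<^sub>m A) *\<^sub>v v = c \<cdot>\<^sub>v (A *\<^sub>v v)"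
  using assms by (intro eq_vecI) auto

lemma eigenvector_smult_mat:
  fixes A :: "'a :: comm_ring_1 mat"
  assumes "A \<in> carrier_mat n n" and "eigenvector A v \<mu>"
  shows "eigenvector (c \<cdot>\<^sub>m A) v (c * \<mu>)"
  using assms by (auto simp: eigenvector_def smult_mat_mult_vec smult_smult_assoc)

text \<open>Conjugating the eigenvector equation leaves the real matrix and the real eigenvalue
  fixed.\<close>

lemma eigenvector_conjugate_real:
  assumes A: "A \<in> carrier_mat n n"
    and v: "eigenvector (map_mat complex_of_real A) v (complex_of_real \<mu>)"
  shows "eigenvector (map_mat complex_of_real A) (conjugate v) (complex_of_real \<mu>)"
proof -
  let ?A = "map_mat complex_of_real A"
  have vn: "v \<in> carrier_vec n" and v0: "v \<noteq> 0\<^sub>v n" and ev: "?A *\<^sub>v v = complex_of_real \<mu> \<cdot>\<^sub>v v"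
    using A v by (auto simp: eigenvector_def)
  have "?A *\<^sub>v conjugate v = conjugate (?A *\<^sub>v v)"
    using A vn by (intro eq_vecI) (auto simp: scalar_prod_def sum_conjugate)
  also have "\<dots> = complex_of_real \<mu> \<cdot>\<^sub>v conjugate v"
    by (simp add: ev conjugate_smult_vec)
  finally show ?thesis
    using A vn v0 by (simp add: eigenvector_def)
qed

lemma laplacian_mat_carrier: "laplacian_mat n w \<in> carrier_mat n n"
  by (auto simp: laplacian_mat_def degree_mat_def adjacency_mat_def mat_diag_def)

lemma transpose_laplacian_mat:
  assumes "weighted_graph n w"
  shows "(laplacian_mat n w)\<^sup>T = laplacian_mat n w"
  using assms
  by (intro eq_matI)
    (auto simp: laplacian_mat_def degree_mat_def adjacency_mat_def mat_diag_def weighted_graph_def)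

lemma eigenvector_laplacian_conjugate:
  assumes "eigenvector (laplacian_mat n w) v (complex_of_real \<mu>)"
  shows "eigenvector (laplacian_mat n w) (conjugate v) (complex_of_real \<mu>)"
  using assms unfolding laplacian_mat_def
  by (rule eigenvector_conjugate_real[rotated, where n = n])
    (auto simp: degree_mat_def adjacency_mat_def mat_diag_def)

text \<open>Scaling by \<open>- \<i> * \<tau>\<close> keeps the Laplacian symmetric and turns its
  eigenvalue into an imaginary number, whose exponential is a phase.\<close>

lemma scalar_prod_laplacian_exp:
  assumes w: "weighted_graph n w"
    and v: "eigenvector (laplacian_mat n w) v (complex_of_real \<mu>)"
    and u: "u \<in> carrier_vec n"
  shows "v \<bullet> (mat_exp ((- \<i> * complex_of_real \<tau>) \<cdot>\<^sub>m laplacian_mat n w) *\<^sub>v u)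
    = cis (- \<tau> * \<mu>) * (v \<bullet> u)"
proof -
  let ?A = "(- \<i> * complex_of_real \<tau>) \<cdot>\<^sub>m laplacian_mat n w"
  have "?A\<^sup>T = (- \<i> * complex_of_real \<tau>) \<cdot>\<^sub>m (laplacian_mat n w)\<^sup>T"
    by (intro eq_matI) auto
  then have "?A\<^sup>T = ?A"
    by (simp only: transpose_laplacian_mat[OF w])
  moreover have "?A \<in> carrier_mat n n"
    using laplacian_mat_carrier by simp
  ultimately show ?thesis
    using scalar_prod_mat_exp_symmetric[OF _ _ eigenvector_smult_mat[OF laplacian_mat_carrier v] u]
    by (simp add: cis_conv_exp mult_ac)
qed

text \<open>The pairings are the entries of \<open>mat_adjoint H *\<^sub>v x\<close>, and applying
  \<open>H\<close> to that vector gives \<open>n\<close> times \<open>x\<close>.\<close>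

lemma hadamard_vec_eqI:
  assumes H: "complex_hadamard n H" and n: "0 < n"
    and x: "x \<in> carrier_vec n" and y: "y \<in> carrier_vec n"
    and eq: "\<And>j. j < n \<Longrightarrow> conjugate (col H j) \<bullet> x = conjugate (col H j) \<bullet> y"
  shows "x = y"
proof -
  have Hc: "H \<in> carrier_mat n n" and HH: "H * mat_adjoint H = of_nat n \<cdot>\<^sub>m 1\<^sub>m n"
    using H by (auto simp: complex_hadamard_def)
  have Ac: "mat_adjoint H \<in> carrier_mat n n"
    using Hc by (intro carrier_matI) (simp_all add: mat_adjoint_def)
  have "mat_adjoint H *\<^sub>v x = mat_adjoint H *\<^sub>v y"
    using Hc Ac eq by (intro eq_vecI) (auto simp: mat_adjoint_def)
  then have "H * mat_adjoint H *\<^sub>v x = H * mat_adjoint H *\<^sub>v y"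
    using Hc Ac x y by simp
  then have "of_nat n \<cdot>\<^sub>v x = (of_nat n :: complex) \<cdot>\<^sub>v y"
    using x y by (simp add: HH smult_mat_mult_vec[of _ n n])
  then show ?thesis
    using x y n by (auto simp: vec_eq_iff)
qed

text \<open>The first equation for each \<open>j\<close> comes from pairing with column
  \<open>j\<close>, the second from pairing with its conjugate, an eigenvector for the same
  \<open>l j\<close>. The conjugated pairings determine a vector, which gives the converse.\<close>

lemma exp_laplacian_unit_vec_eq_iff:
  assumes w: "weighted_graph n w" and H: "complex_hadamard n H"
    and ev: "\<And>j. j < n \<Longrightarrow> eigenvector (laplacian_mat n w) (col H j) (complex_of_real (l j))"
    and a: "a < n" and b: "b < n"
  shows "mat_exp ((- \<i> * complex_of_real \<tau>) \<cdot>\<^sub>m laplacian_mat n w) *\<^sub>v unit_vec n a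
       = \<alpha> \<cdot>\<^sub>v unit_vec n a + \<beta> \<cdot>\<^sub>v unit_vec n b
    \<longleftrightarrow> (\<forall>j<n. cis (- \<tau> * l j) * H $$ (a, j) = \<alpha> * H $$ (a, j) + \<beta> * H $$ (b, j) \<and>
          cis (- \<tau> * l j) * cnj (H $$ (a, j)) = \<alpha> * cnj (H $$ (a, j)) + \<beta> * cnj (H $$ (b, j)))"
    (is "?x = ?y \<longleftrightarrow> ?R")
proof
  let ?L = "laplacian_mat n w"
  have Hc: "H \<in> carrier_mat n n"
    using H by (simp add: complex_hadamard_def)
  have xc: "?x \<in> carrier_vec n" and yc: "?y \<in> carrier_vec n"
    using mat_exp_carrier[of "(- \<i> * complex_of_real \<tau>) \<cdot>\<^sub>m ?L" n] laplacian_mat_carrier[of n w]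
    by auto
  have x: "v \<bullet> ?x = cis (- \<tau> * l j) * v $ a"
    if "eigenvector ?L v (complex_of_real (l j))" "v \<in> carrier_vec n" for v j
    using scalar_prod_laplacian_exp[OF w that(1), of "unit_vec n a" \<tau>] that(2) a by simp
  have y: "v \<bullet> ?y = \<alpha> * v $ a + \<beta> * v $ b" if "v \<in> carrier_vec n" for v
    using that a b by (simp add: scalar_prod_add_distrib[of _ n])
  have colc: "col H j \<in> carrier_vec n" for j
    using Hc by auto
  note ev' = eigenvector_laplacian_conjugate[OF ev]
  show ?R if eq: "?x = ?y"
  proof (intro allI impI conjI)
    fix j assume j: "j < n"
    show "cis (- \<tau> * l j) * H $$ (a, j) = \<alpha> * H $$ (a, j) + \<beta> * H $$ (b, j)"
      using trans[OF x[OF ev[OF j] colc, symmetric, unfolded eq] y[OF colc]] Hc a b j by simp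
    show "cis (- \<tau> * l j) * cnj (H $$ (a, j)) = \<alpha> * cnj (H $$ (a, j)) + \<beta> * cnj (H $$ (b, j))"
      using trans[OF x[OF ev'[OF j], symmetric, unfolded eq] y] colc[of j] Hc a b j by simp
  qed
  show "?x = ?y" if R: ?R
  proof (rule hadamard_vec_eqI[OF H _ xc yc])
    show "0 < n" using a by simp
    fix j assume j: "j < n"
    show "conjugate (col H j) \<bullet> ?x = conjugate (col H j) \<bullet> ?y"
      using x[OF ev'[OF j]] y[of "conjugate (col H j)"] R colc[of j] Hc a b j by simp
  qed
qed

section \<open>The pair of scalar equations for one column\<close>

lemma unit_complex_eq_or_minus:
  fixes p q :: complex
  assumes "cmod p = 1" "cmod q = 1" and eq: "p * cnj q = cnj p * q"
  shows "p = q \<or> p = - q"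
proof -
  have "p * cnj p = 1" "q * cnj q = 1"
    using assms by (simp_all add: complex_norm_square[symmetric])
  \<comment> \<open>Inserting \<open>q * cnj q = 1\<close> makes the factor \<open>p * cnj q\<close>
    appear; swapping it by \<open>eq\<close> trades \<open>p ^ 2\<close> for
    \<open>q ^ 2\<close>.\<close>
  have "p ^ 2 = p ^ 2 * (q * cnj q)"
    unfolding \<open>q * cnj q = 1\<close> by simp
  also have "\<dots> = p * (p * cnj q) * q"
    by (simp only: power2_eq_square mult_ac)
  also have "\<dots> = p * cnj p * q ^ 2"
    unfolding eq by (simp only: power2_eq_square mult_ac)
  also have "\<dots> = q ^ 2"
    unfolding \<open>p * cnj p = 1\<close> by simp
  finally have "p ^ 2 = q ^ 2" .
  then show ?thesis
    by (simp add: power2_eq_iff)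
qed

lemma revival_equation_iff:
  fixes p q :: complex and \<theta> \<gamma> :: real
  defines "\<alpha> \<equiv> exp (\<i> * complex_of_real \<gamma>) * complex_of_real (cos \<gamma>)"
    and "\<beta> \<equiv> - exp (\<i> * complex_of_real \<gamma>) * \<i> * complex_of_real (sin \<gamma>)"
  assumes p: "cmod p = 1" and q: "cmod q = 1" and \<beta>: "\<beta> \<noteq> 0"
  shows "cis \<theta> * p = \<alpha> * p + \<beta> * q \<and> cis \<theta> * cnj p = \<alpha> * cnj p + \<beta> * cnj q
    \<longleftrightarrow> (p = q \<or> p = - q) \<and> (p = q \<longrightarrow> [\<theta> = 0] (rmod (2 * pi))) \<and>
        (p = - q \<longrightarrow> [\<theta> = 2 * \<gamma>] (rmod (2 * pi)))"
    (is "?E p q \<longleftrightarrow> ?R")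
proof -
  have "\<alpha> = cis \<gamma> * complex_of_real (cos \<gamma>)" "\<beta> = - cis \<gamma> * (\<i> * complex_of_real (sin \<gamma>))"
    by (simp_all add: \<alpha>_def \<beta>_def cis_conv_exp)
  \<comment> \<open>After factoring out \<open>cis \<gamma>\<close>, the sum leaves
    \<open>cos \<gamma> - \<i> * sin \<gamma>\<close> and the difference leaves its
    conjugate.\<close>
  then have "\<alpha> + \<beta> = cis \<gamma> * cis (- \<gamma>)" "\<alpha> - \<beta> = cis \<gamma> * cis \<gamma>"
    by (simp_all add: complex_eq_iff algebra_simps)
  then have sum: "\<alpha> + \<beta> = cis 0" and diff: "\<alpha> - \<beta> = cis (2 * \<gamma>)"
    by (simp_all add: cis_mult)
  have q0: "q \<noteq> 0" using q by auto
  have plus: "?E q q \<longleftrightarrow> [\<theta> = 0] (rmod (2 * pi))"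
  proof -
    have "?E q q \<longleftrightarrow> cis \<theta> = \<alpha> + \<beta>"
      using q0 by (auto simp: distrib_right[symmetric])
    then show ?thesis by (simp only: sum cis_eq_iff_rcong)
  qed
  have minus: "?E (- q) q \<longleftrightarrow> [\<theta> = 2 * \<gamma>] (rmod (2 * pi))"
  proof -
    have "?E (- q) q \<longleftrightarrow> cis \<theta> * q = (\<alpha> - \<beta>) * q \<and> cis \<theta> * cnj q = (\<alpha> - \<beta>) * cnj q"
      by (auto simp: algebra_simps)
    also have "\<dots> \<longleftrightarrow> cis \<theta> = \<alpha> - \<beta>"
      using q0 by auto
    finally show ?thesis by (simp only: diff cis_eq_iff_rcong)
  qed
  have pm: "p = q \<or> p = - q" if "?E p q"
  proof -
    \<comment> \<open>Multiplying the equations by \<open>cnj p\<close> and \<open>p\<close> makes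
      their left sides agree. The \<alpha> terms then cancel, and dividing by \<beta> shows that
      \<open>p * cnj q\<close> is real.\<close>
    have "cis \<theta> * p * cnj p = (\<alpha> * p + \<beta> * q) * cnj p"
      "cis \<theta> * cnj p * p = (\<alpha> * cnj p + \<beta> * cnj q) * p"
      unfolding that[THEN conjunct1] that[THEN conjunct2] by (rule refl)+
    moreover have "cis \<theta> * p * cnj p = cis \<theta> * cnj p * p"
      by (simp only: mult_ac)
    ultimately have "(\<alpha> * p + \<beta> * q) * cnj p = (\<alpha> * cnj p + \<beta> * cnj q) * p"
      by (simp only:)
    then have "\<beta> * (p * cnj q) = \<beta> * (cnj p * q)"
      by (auto simp: algebra_simps)
    then show ?thesis
      using \<beta> p q by (intro unit_complex_eq_or_minus) auto
  qed
  \<comment> \<open>The two signs exclude each other, so only one of the congruences is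
    imposed.\<close>
  have "q \<noteq> - q" using q0 by simp
  then show ?thesis
    using plus minus pm by (cases "p = q"; cases "p = - q") auto
qed

theorem corollary4p2:
  fixes n :: nat
    and w :: "nat \<Rightarrow> nat \<Rightarrow> real"
    and H :: "complex mat"
    and l :: "nat \<Rightarrow> real"
    and a b :: nat
    and \<tau> \<gamma> :: real
  assumes "weighted_graph n w"
    and "complex_hadamard n H"
    and "dephased n H"
    and "diagonalisable_by (laplacian_mat n w) H"
    and "\<forall>j<n. eigenvector (laplacian_mat n w) (col H j) (complex_of_real (l j))"
    and "a < n" and "b < n" and "a \<noteq> b"
    and "- (pi / 2) < \<gamma>" and "\<gamma> \<le> pi / 2" and "\<gamma> \<noteq> 0"
  shows "fractional_revival n w
           (exp (\<i> * complex_of_real \<gamma>) * complex_of_real (cos \<gamma>))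
           (- exp (\<i> * complex_of_real \<gamma>) * \<i> * complex_of_real (sin \<gamma>))
           a b \<tau>
         \<longleftrightarrow>
         (\<forall>j<n.
            (H $$ (a, j) = H $$ (b, j) \<or> H $$ (a, j) = - H $$ (b, j)) \<and>
            (H $$ (a, j) = H $$ (b, j) \<longrightarrow> [- \<tau> * l j = 0] (rmod (2 * pi))) \<and>
            (H $$ (a, j) = - H $$ (b, j) \<longrightarrow> [- \<tau> * l j = 2 * \<gamma>] (rmod (2 * pi))))"
proof -
  let ?\<alpha> = "exp (\<i> * complex_of_real \<gamma>) * complex_of_real (cos \<gamma>)"
  let ?\<beta> = "- exp (\<i> * complex_of_real \<gamma>) * \<i> * complex_of_real (sin \<gamma>)"
  \<comment> \<open>The zeros of the sine are the integer multiples of pi, and 0 is the only one in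
    the range of \<gamma>.\<close>
  have "sin \<gamma> \<noteq> 0"
  proof
    assume "sin \<gamma> = 0"
    moreover have "\<bar>\<gamma>\<bar> < pi"
      using assms(9,10) pi_gt_zero by linarith
    ultimately show False
      using \<open>\<gamma> \<noteq> 0\<close> by (auto simp: sin_zero_iff_int2 abs_mult)
  qed
  then have \<beta>: "?\<beta> \<noteq> 0"
    by simp
  \<comment> \<open>The exponential factor has modulus one, so this is \<open>cos\<close> squared
    plus \<open>sin\<close> squared.\<close>
  have norm: "(cmod ?\<alpha>)\<^sup>2 + (cmod ?\<beta>)\<^sup>2 = 1"
    by (simp add: norm_mult)
  have unit: "cmod (H $$ (i, j)) = 1" if "i < n" "j < n" for i j
    using assms(2) that by (simp add: complex_hadamard_def)
  have "fractional_revival n w ?\<alpha> ?\<beta> a b \<tau> \<longleftrightarrow>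
    (\<forall>j<n. cis (- \<tau> * l j) * H $$ (a, j) = ?\<alpha> * H $$ (a, j) + ?\<beta> * H $$ (b, j) \<and>
      cis (- \<tau> * l j) * cnj (H $$ (a, j)) = ?\<alpha> * cnj (H $$ (a, j)) + ?\<beta> * cnj (H $$ (b, j)))"
    using exp_laplacian_unit_vec_eq_iff[OF assms(1,2) _ assms(6,7), of l \<tau> ?\<alpha> ?\<beta>] assms(5) \<beta> norm
    unfolding fractional_revival_def by blast
  also have "\<dots> \<longleftrightarrow> (\<forall>j<n.
      (H $$ (a, j) = H $$ (b, j) \<or> H $$ (a, j) = - H $$ (b, j)) \<and>
      (H $$ (a, j) = H $$ (b, j) \<longrightarrow> [- \<tau> * l j = 0] (rmod (2 * pi))) \<and>
      (H $$ (a, j) = - H $$ (b, j) \<longrightarrow> [- \<tau> * l j = 2 * \<gamma>] (rmod (2 * pi))))"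
    using revival_equation_iff[OF unit[OF assms(6)] unit[OF assms(7)] \<beta>] by blast
  finally show ?thesis .
qed

end
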